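(* Let $q$ be a prime power and let $f(x)=x^q-x^{q^2}+x^{q^4}+x^{q^5}\in\mathbb{F}_{q^6}[x]$. Then $f(x)$ is a scattered $q$-polynomial over $\mathbb{F}_{q^6}$ if and only if $q\equiv 1\pmod 4$.
   Context: For a $q$-polynomial $f(x)=\sum_{i=0}^{n-1}a_ix^{q^i}\in\mathbb{F}_{q^n}[x]$ let $U_f=\{(x,f(x)):x\in\mathbb{F}_{q^n}\}$, an $n$-dimensional $\mathbb{F}_q$-subspace of $\mathbb{F}_{q^n}^2$, and let $L_f=\{\langle \mathbf{u}\rangle_{\mathbb{F}_{q^n}}:\mathbf{u}\in U_f\setminus\{\mathbf 0\}\}\subseteq \mathrm{PG}(1,q^n)$ be the associated linear set. The polynomial $f$ is called scattered if $L_f$ is maximum scattered, i.e. $|L_f|=(q^n-1)/(q-1)$ (equivalently, $f(x)/x$ takes exactly $(q^n-1)/(q-1)$ values on $\mathbb{F}_{q^n}\setminus\{0\}$). Here $n=6$. *)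

theory Defs
  imports
    "HOL-Analysis.Cartesian_Space"
    "HOL-Computational_Algebra.Polynomial"
    "HOL-Number_Theory.Cong"
    "HOL-Number_Theory.Prime_Powers"
begin

text \<open>
  The field of \<open>q ^ n\<close> elements is a type \<open>'a\<close> of sorts \<open>field\<close> and \<open>finite\<close> with
  \<open>CARD('a) = q ^ n\<close>. The definitions below take \<open>q\<close> and \<open>n\<close> as explicit parameters and are
  meant to be used under that assumption.
\<close>

definition q_polynomial :: "nat \<Rightarrow> nat \<Rightarrow> 'a::field poly \<Rightarrow> bool" where
  "q_polynomial q n f \<longleftrightarrow> (\<exists>a :: nat \<Rightarrow> 'a. f = (\<Sum>i<n. monom (a i) (q ^ i)))"

definition graph_subspace :: "'a::field poly \<Rightarrow> ('a ^ 2) set" where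
  "graph_subspace f = {vector [x, poly f x] | x. True}"

text \<open>
  The points of the projective line over \<open>'a\<close> are the one-dimensional subspaces of \<open>'a ^ 2\<close>,
  so the point of a nonzero vector \<open>u\<close> is \<open>vec.span {u}\<close>, the span over all of \<open>'a\<close>
  (not over the subfield of order \<open>q\<close>).
\<close>

definition linear_set :: "('a::field ^ 2) set \<Rightarrow> ('a ^ 2) set set" where
  "linear_set U = {vec.span {u} | u. u \<in> U - {0}}"

text \<open>The division is exact: \<open>q - 1\<close> divides \<open>q ^ n - 1\<close>.\<close>

definition scattered_q_polynomial :: "nat \<Rightarrow> nat \<Rightarrow> 'a::field poly \<Rightarrow> bool" where
  "scattered_q_polynomial q n f \<longleftrightarrow>
     q_polynomial q n f \<and>
     card (linear_set (graph_subspace f)) = (q ^ n - 1) div (q - 1)"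

end

theory Submission
  imports Defs
begin

text \<open>
  Write \<open>\<sigma> x = x\<^sup>q\<close> and \<open>\<tau> = \<sigma>\<^sup>3\<close>, the involution of the field over its subfield of order
  \<open>q\<^sup>3\<close>. Counting the fibres of \<open>x \<mapsto> \<langle>(x, f x)\<rangle>\<close> shows that \<open>f\<close> is scattered iff
  \<open>f x / x = f y / y\<close> forces \<open>\<sigma> (y / x) = y / x\<close> (lemma \<open>card_linear_set_graph_iff\<close>).

  The key point is that \<open>f\<close> is diagonal for the eigenspaces of \<open>\<tau>\<close>: with \<open>u = x + \<tau> x\<close> and
  \<open>v = x - \<tau> x\<close> one has \<open>f x = \<sigma> u - \<sigma>\<^sup>2 v\<close>. For odd \<open>q\<close>, put \<open>v = \<sigma> t\<close>. Then \<open>f x = m x\<close>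
  becomes the system \<open>\<sigma> u = a u + b \<sigma> t\<close>, \<open>t = b u + a \<sigma> t\<close>, where \<open>\<tau>\<close> fixes \<open>u\<close> and \<open>a\<close> and
  negates \<open>t\<close> and \<open>b\<close>. For two solutions with the same \<open>m\<close>, the determinant
  \<open>D = u t' - u' t\<close> satisfies both \<open>\<sigma> D = D\<close> and \<open>\<tau> D = - D\<close>, hence vanishes. So the solutions
  are proportional; unless \<open>a = 0\<close>, the system forces the factor to be fixed by \<open>\<sigma>\<close>. If \<open>a = 0\<close>,
  it forces \<open>b \<sigma> b = 1\<close>, and with \<open>\<tau> b = - b\<close> this means \<open>b\<^sup>2 = -1\<close> and \<open>\<sigma> b = - b\<close>
  (lemma \<open>ratio_fixed_if_same_slope\<close>).

  A square root \<open>b\<close> of \<open>-1\<close> satisfies \<open>b\<^sup>4 = 1\<close>, so \<open>\<sigma> b = b\<close> if \<open>q \<equiv> 1 (mod 4)\<close> and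
  \<open>\<sigma> b = - b\<close> if \<open>q \<equiv> 3 (mod 4)\<close>. In the first case \<open>f\<close> is therefore scattered. In the second
  case such a \<open>b\<close> exists and all \<open>u - b \<sigma> u\<close> with \<open>\<tau> u = u\<close> have the same slope \<open>2 b\<close>. For even
  \<open>q\<close> all \<open>u\<close> with \<open>\<tau> u = u\<close> have slope \<open>0\<close>. Either way \<open>f\<close> is not scattered, because
  \<open>\<tau>\<close> fixes more elements than \<open>\<sigma>\<close>.
\<close>

section \<open>Roots of unity and the Frobenius map of a finite field\<close>

lemma finite_field_power_card_minus_one:
  fixes x :: "'a::{field,finite}"
  assumes "x \<noteq> 0"
  shows "x ^ (CARD('a) - 1) = 1"
proof -
  have "(\<Prod>y\<in>UNIV - {0}. y) = (\<Prod>y\<in>UNIV - {0}. x * y)"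
    by (rule prod.reindex_bij_witness[of _ "\<lambda>y. x * y" "\<lambda>y. y / x"]) (use assms in auto)
  also have "\<dots> = x ^ (CARD('a) - 1) * (\<Prod>y\<in>UNIV - {0}. y)"
    by (simp add: prod.distrib)
  finally show ?thesis
    by simp
qed

lemma card_roots_of_unity_le:
  fixes d :: nat
  assumes "d > 0"
  shows "card {x::'a::{field,finite}. x ^ d = 1} \<le> d"
proof -
  have deg: "degree (monom (1::'a) d - 1) \<le> d"
    by (rule degree_diff_le) (auto simp: degree_monom_le)
  have "coeff (monom (1::'a) d - 1) d = 1"
    using assms by simp
  hence "monom (1::'a) d - 1 \<noteq> 0"
    by (metis coeff_0 zero_neq_one)
  from card_poly_roots_bound[OF this] deg show ?thesis
    by (simp add: poly_monom)
qed

text \<open>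
  The map \<open>x \<mapsto> x\<^sup>d\<close> sends the \<open>d * e\<close> nonzero elements to \<open>e\<close>-th roots of unity, of which there
  are at most \<open>e\<close>, and its fibres are no larger than the set of \<open>d\<close>-th roots of unity.
\<close>

lemma card_roots_of_unity:
  fixes d :: nat
  assumes "d dvd CARD('a) - 1"
  shows "card {x::'a::{field,finite}. x ^ d = 1} = d"
proof -
  let ?S = "UNIV - {0::'a}" and ?R = "{x::'a. x ^ d = 1}"
  obtain e where e: "CARD('a) - 1 = d * e"
    using assms by blast
  have "card {0, 1 :: 'a} \<le> CARD('a)"
    by (rule card_mono) auto
  hence pos: "d > 0" "e > 0"
    using e by (auto intro!: Nat.gr0I)
  have fibre: "card {x \<in> ?S. x ^ d = b} \<le> card ?R" if b: "b \<in> (\<lambda>x. x ^ d) ` ?S" for b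
  proof -
    obtain z where z: "z \<noteq> 0" "b = z ^ d"
      using b by auto
    show ?thesis
      by (rule card_inj_on_le[of "\<lambda>x. x / z"]) (use z in \<open>auto simp: inj_on_def power_divide\<close>)
  qed
  have image: "(\<lambda>x. x ^ d) ` ?S \<subseteq> {x. x ^ e = 1}"
    using finite_field_power_card_minus_one[where 'a = 'a] by (auto simp flip: power_mult e)
  have "d * e = card ?S"
    using e by (simp add: card_Diff_subset)
  also have "\<dots> = (\<Sum>b\<in>(\<lambda>x. x ^ d) ` ?S. card {x \<in> ?S. x ^ d = b})"
    using sum.image_gen[of ?S "\<lambda>_. 1::nat" "\<lambda>x. x ^ d"] by simp
  also have "\<dots> \<le> card ((\<lambda>x. x ^ d) ` ?S) * card ?R"
    using sum_bounded_above[OF fibre] by simp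
  also have "\<dots> \<le> e * card ?R"
    using card_mono[OF _ image] card_roots_of_unity_le[where 'a = 'a, OF pos(2)]
    by (intro mult_right_mono) auto
  finally have "d \<le> card ?R"
    using pos by (simp add: mult.commute)
  thus ?thesis
    using card_roots_of_unity_le[where 'a = 'a, OF pos(1)] by simp
qed

lemma minus_one_dvd_power_minus_one:
  fixes q n :: nat
  shows "q - 1 dvd q ^ n - 1"
proof (cases "q = 0")
  case False
  hence "int (q - 1) dvd int (q ^ n - 1)"
    using power_diff_1_eq[of "int q" n] by (simp add: of_nat_diff)
  thus ?thesis
    by (simp only: of_nat_dvd_iff)
qed (cases n; simp)

lemma power_eq_self_iff:
  fixes x :: "'a::field"
  assumes "q > 0"
  shows "x ^ q = x \<longleftrightarrow> x = 0 \<or> x ^ (q - 1) = 1"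
  using assms power_minus_mult[of q x] by (cases "x = 0") auto

lemma card_nonzero_power_eq_self:
  fixes q :: nat
  assumes "q > 1" "CARD('a) = q ^ n"
  shows "card {c::'a::{field,finite}. c \<noteq> 0 \<and> c ^ q = c} = q - 1"
proof -
  have "{c::'a. c \<noteq> 0 \<and> c ^ q = c} = {c. c ^ (q - 1) = 1}"
    using assms(1) by (auto simp: power_eq_self_iff power_0_left)
  thus ?thesis
    using card_roots_of_unity[where 'a = 'a, of "q - 1"] assms(2) minus_one_dvd_power_minus_one
    by simp
qed

text \<open>
  Shifting the summation variable in \<open>\<Sum>x. x\<close> by \<open>1\<close> shows that the number of elements, a
  power of \<open>p\<close>, vanishes in the field.
\<close>

lemma prime_char_of_card:
  assumes "prime p" "CARD('a) = p ^ k"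
  shows "CHAR('a::{field,finite}) = p"
proof -
  have "(\<Sum>x\<in>UNIV. x :: 'a) = (\<Sum>x\<in>UNIV. x + 1)"
    by (rule sum.reindex_bij_witness[of _ "\<lambda>x. x + 1" "\<lambda>x. x - 1"]) auto
  hence "of_nat p ^ k = (0 :: 'a)"
    using assms(2) by (simp add: sum.distrib)
  hence "CHAR('a) dvd p"
    by (simp add: of_nat_eq_0_iff_char_dvd[symmetric])
  thus ?thesis
    using assms(1) CHAR_not_1' by (metis One_nat_def prime_nat_iff)
qed

section \<open>Scatteredness as a condition on slopes\<close>

lemma span_eq_span_iff_same_slope:
  fixes x y c d :: "'a::field"
  assumes "x \<noteq> 0" "y \<noteq> 0"
  shows "vec.span {vector [x, c] :: 'a ^ 2} = vec.span {vector [y, d]} \<longleftrightarrow> c * y = d * x"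
proof
  assume "vec.span {vector [x, c] :: 'a ^ 2} = vec.span {vector [y, d]}"
  hence "(vector [x, c] :: 'a ^ 2) \<in> vec.span {vector [y, d]}"
    using vec.span_base[of "vector [x, c] :: 'a ^ 2" "{vector [x, c]}"] by simp
  then obtain k where "(vector [x, c] :: 'a ^ 2) = k *s vector [y, d]"
    by (auto simp: vec.span_singleton)
  hence "x = k * y" "c = k * d"
    by (auto simp: vec_eq_iff forall_2)
  thus "c * y = d * x"
    by simp
next
  assume *: "c * y = d * x"
  have "(vector [x, c] :: 'a ^ 2) = (x / y) *s vector [y, d]"
    using assms * by (simp add: vec_eq_iff forall_2 field_simps)
  moreover have "(vector [y, d] :: 'a ^ 2) = (y / x) *s vector [x, c]"
    using assms * by (simp add: vec_eq_iff forall_2 field_simps)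
  ultimately have "(vector [x, c] :: 'a ^ 2) \<in> vec.span {vector [y, d]}"
    "(vector [y, d] :: 'a ^ 2) \<in> vec.span {vector [x, c]}"
    unfolding vec.span_singleton by blast+
  thus "vec.span {vector [x, c] :: 'a ^ 2} = vec.span {vector [y, d]}"
    by (simp add: vec.span_eq)
qed

lemma linear_set_graph_subspace:
  fixes f :: "'a::field poly"
  assumes "poly f 0 = 0"
  shows "linear_set (graph_subspace f) = (\<lambda>x. vec.span {vector [x, poly f x]}) ` (UNIV - {0})"
proof -
  have "vector [x, poly f x] = (0 :: 'a ^ 2) \<longleftrightarrow> x = 0" for x
    using assms by (auto simp: vec_eq_iff forall_2)
  thus ?thesis
    by (fastforce simp: linear_set_def graph_subspace_def)
qed

text \<open>
  The fibre of \<open>x \<mapsto> \<langle>(x, f x)\<rangle>\<close> through \<open>x\<close> contains the \<open>q - 1\<close> nonzero multiples \<open>c x\<close> with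
  \<open>c\<^sup>q = c\<close>. Since there are \<open>q\<^sup>n - 1\<close> nonzero elements, the number of points is
  \<open>(q\<^sup>n - 1) / (q - 1)\<close> iff no fibre contains anything else.
\<close>

lemma card_linear_set_graph_iff:
  fixes f :: "'a::{field,finite} poly"
  assumes q: "q > 1" and card: "CARD('a) = q ^ n"
    and homogeneous: "\<And>c x. c ^ q = c \<Longrightarrow> poly f (c * x) = c * poly f x"
  shows "card (linear_set (graph_subspace f)) = (q ^ n - 1) div (q - 1) \<longleftrightarrow>
    (\<forall>x y. x \<noteq> 0 \<longrightarrow> poly f x * y = poly f y * x \<longrightarrow> (y / x) ^ q = y / x)"
proof -
  let ?S = "UNIV - {0::'a}" and ?K = "{c::'a. c \<noteq> 0 \<and> c ^ q = c}"
  define P where "P x = vec.span {vector [x, poly f x] :: 'a ^ 2}" for x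
  define fibre where "fibre b = {y \<in> ?S. P y = b}" for b
  have f0: "poly f 0 = 0"
    using homogeneous[of 0 0] q by simp
  have P: "P y = P x \<longleftrightarrow> poly f x * y = poly f y * x" if "x \<noteq> 0" "y \<noteq> 0" for x y
    using that unfolding P_def by (subst span_eq_span_iff_same_slope) auto
  have multiples: "(\<lambda>c. c * x) ` ?K \<subseteq> fibre (P x)" if "x \<noteq> 0" for x
  proof
    fix y
    assume "y \<in> (\<lambda>c. c * x) ` ?K"
    then obtain c where c: "y = c * x" "c \<noteq> 0" "c ^ q = c"
      by auto
    hence "P y = P x"
      using that by (subst P) (auto simp: homogeneous)
    thus "y \<in> fibre (P x)"
      using c that by (simp add: fibre_def)
  qed
  have card_multiples: "card ((\<lambda>c. c * x) ` ?K) = q - 1" if "x \<noteq> 0" for x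
    using that card_nonzero_power_eq_self[OF q card]
    by (subst card_image) (auto simp: inj_on_def)
  have fibre_ge: "q - 1 \<le> card (fibre b)" if "b \<in> P ` ?S" for b
    using that card_mono[OF _ multiples] card_multiples by fastforce
  have total: "q ^ n - 1 = (\<Sum>b\<in>P ` ?S. card (fibre b))"
    using sum.image_gen[of ?S "\<lambda>_. 1::nat" P] by (simp add: fibre_def card)
  have "card (linear_set (graph_subspace f)) = card (P ` ?S)"
    by (simp add: linear_set_graph_subspace f0 P_def)
  hence "card (linear_set (graph_subspace f)) = (q ^ n - 1) div (q - 1) \<longleftrightarrow>
      (\<Sum>b\<in>P ` ?S. q - 1) = (\<Sum>b\<in>P ` ?S. card (fibre b))"
    using q minus_one_dvd_power_minus_one[of q n]
    by (auto simp flip: total simp: mult.commute)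
  also have "\<dots> \<longleftrightarrow> (\<forall>b\<in>P ` ?S. card (fibre b) = q - 1)"
    (is "?eq \<longleftrightarrow> ?all")
  proof
    assume ?eq
    show ?all
      using sum_mono_inv[OF \<open>?eq\<close> fibre_ge] by simp
  next
    assume ?all
    thus ?eq
      by (intro sum.cong refl) metis
  qed
  also have "\<dots> \<longleftrightarrow> (\<forall>x. x \<noteq> 0 \<longrightarrow> card (fibre (P x)) = q - 1)"
    by auto
  also have "\<dots> \<longleftrightarrow> (\<forall>x. x \<noteq> 0 \<longrightarrow> fibre (P x) \<subseteq> (\<lambda>c. c * x) ` ?K)"
  proof -
    have "card (fibre (P x)) = q - 1 \<longleftrightarrow> fibre (P x) \<subseteq> (\<lambda>c. c * x) ` ?K" if "x \<noteq> 0" for x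
    proof
      assume "card (fibre (P x)) = q - 1"
      hence "(\<lambda>c. c * x) ` ?K = fibre (P x)"
        using card_multiples[OF that] by (intro card_subset_eq multiples that) simp_all
      thus "fibre (P x) \<subseteq> (\<lambda>c. c * x) ` ?K"
        by simp
    next
      assume "fibre (P x) \<subseteq> (\<lambda>c. c * x) ` ?K"
      hence "fibre (P x) = (\<lambda>c. c * x) ` ?K"
        using multiples[OF that] by (rule subset_antisym)
      thus "card (fibre (P x)) = q - 1"
        using card_multiples[OF that] by (simp only:)
    qed
    thus ?thesis
      by simp
  qed
  also have "\<dots> \<longleftrightarrow> (\<forall>x y. x \<noteq> 0 \<longrightarrow> y \<noteq> 0 \<longrightarrow> P y = P x \<longrightarrow> (y / x) ^ q = y / x)"
  proof -
    have "y \<in> (\<lambda>c. c * x) ` ?K \<longleftrightarrow> (y / x) ^ q = y / x" if "x \<noteq> 0" "y \<noteq> 0" for x y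
    proof
      assume "(y / x) ^ q = y / x"
      thus "y \<in> (\<lambda>c. c * x) ` ?K"
        using that by (intro image_eqI[of _ _ "y / x"]) auto
    qed (use that in auto)
    moreover have "fibre (P x) \<subseteq> A \<longleftrightarrow> (\<forall>y. y \<noteq> 0 \<longrightarrow> P y = P x \<longrightarrow> y \<in> A)" for x A
      by (auto simp: fibre_def)
    ultimately show ?thesis
      by simp
  qed
  also have "\<dots> \<longleftrightarrow> (\<forall>x y. x \<noteq> 0 \<longrightarrow> poly f x * y = poly f y * x \<longrightarrow> (y / x) ^ q = y / x)"
  proof -
    have "(0 / x) ^ q = 0 / x" for x :: 'a
      using q by simp
    thus ?thesis
      using P by metis
  qed
  finally show ?thesis .
qed

section \<open>The slopes of the map\<close>

text \<open>
  The slope computation uses only that \<open>\<sigma>\<close> is a field automorphism with \<open>\<sigma>\<^sup>6 = 1\<close>.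
\<close>

locale automorphism_of_exponent_six =
  fixes \<sigma> :: "'a::field \<Rightarrow> 'a"
  assumes add [simp]: "\<sigma> (x + y) = \<sigma> x + \<sigma> y"
    and mult [simp]: "\<sigma> (x * y) = \<sigma> x * \<sigma> y"
    and one [simp]: "\<sigma> 1 = 1"
    and exponent_six [simp]: "\<sigma> (\<sigma> (\<sigma> (\<sigma> (\<sigma> (\<sigma> x))))) = x"
begin

definition \<phi> :: "'a \<Rightarrow> 'a" where
  "\<phi> x = \<sigma> x - \<sigma> (\<sigma> x) + \<sigma> (\<sigma> (\<sigma> (\<sigma> x))) + \<sigma> (\<sigma> (\<sigma> (\<sigma> (\<sigma> x))))"

lemma zero [simp]: "\<sigma> 0 = 0"
  by (metis add add.right_neutral add_left_cancel)

lemma uminus [simp]: "\<sigma> (- x) = - \<sigma> x"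
  using add[of x "- x"] by (simp add: eq_neg_iff_add_eq_0 add.commute)

lemma diff [simp]: "\<sigma> (x - y) = \<sigma> x - \<sigma> y"
  using add[of x "- y"] by simp

lemma eq_iff [simp]: "\<sigma> x = \<sigma> y \<longleftrightarrow> x = y"
  by (metis exponent_six)

lemma eq_0_iff [simp]: "\<sigma> x = 0 \<longleftrightarrow> x = 0"
  using eq_iff[of x 0] by simp

lemma divide [simp]: "\<sigma> (x / y) = \<sigma> x / \<sigma> y"
  by (cases "y = 0") (simp_all add: eq_divide_eq flip: mult)

lemma numeral [simp]: "\<sigma> (numeral k) = numeral k"
  by (induction k) (simp_all only: numeral.simps add one)

text \<open>
  The factor \<open>1/4\<close> in \<open>a\<close> and \<open>b\<close> accounts for using \<open>x \<plusminus> \<tau> x\<close> in place of the eigenspace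
  components \<open>(x \<plusminus> \<tau> x) / 2\<close>.
\<close>

lemma eigenspace_system:
  assumes two: "(2::'a) \<noteq> 0" and slope: "\<phi> x = m * x"
  defines "u \<equiv> x + \<sigma> (\<sigma> (\<sigma> x))"
    and "t \<equiv> \<sigma> (\<sigma> (\<sigma> (\<sigma> (\<sigma> x)))) - \<sigma> (\<sigma> x)"
    and "a \<equiv> (m + \<sigma> (\<sigma> (\<sigma> m))) / 4"
    and "b \<equiv> (m - \<sigma> (\<sigma> (\<sigma> m))) / 4"
  shows "\<sigma> u = a * u + b * \<sigma> t" "t = b * u + a * \<sigma> t"
proof -
  have four: "(4::'a) \<noteq> 0"
    using two by (metis mult_2 mult_eq_0_iff numeral_Bit0)
  have ab: "4 * a = m + \<sigma> (\<sigma> (\<sigma> m))" "4 * b = m - \<sigma> (\<sigma> (\<sigma> m))"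
    using four by (simp_all add: a_def b_def)
  have tau_slope: "\<sigma> (\<sigma> (\<sigma> (\<phi> x))) = \<sigma> (\<sigma> (\<sigma> m)) * \<sigma> (\<sigma> (\<sigma> x))"
    by (simp add: slope)
  have "4 * \<sigma> u = 2 * (\<phi> x + \<sigma> (\<sigma> (\<sigma> (\<phi> x))))"
    by (simp add: \<phi>_def u_def)
  also have "\<dots> = (4 * a) * u + (4 * b) * \<sigma> t"
    unfolding tau_slope slope ab by (simp add: u_def t_def algebra_simps)
  also have "\<dots> = 4 * (a * u + b * \<sigma> t)"
    by (simp add: algebra_simps)
  finally show "\<sigma> u = a * u + b * \<sigma> t"
    using four mult_cancel_left by blast
  have "4 * t = 2 * (\<phi> x - \<sigma> (\<sigma> (\<sigma> (\<phi> x))))"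
    by (simp add: \<phi>_def t_def)
  also have "\<dots> = (4 * b) * u + (4 * a) * \<sigma> t"
    unfolding tau_slope slope ab by (simp add: u_def t_def algebra_simps)
  also have "\<dots> = 4 * (b * u + a * \<sigma> t)"
    by (simp add: algebra_simps)
  finally show "t = b * u + a * \<sigma> t"
    using four mult_cancel_left by blast
qed

text \<open>
  For \<open>D = u t' - u' t\<close>, eliminating \<open>a \<sigma> t\<close> and \<open>a \<sigma> t'\<close> from the systems gives \<open>\<sigma> D = D\<close>, while
  \<open>\<tau> D = - D\<close> by the eigenspaces of the four factors.
\<close>

lemma eigenspace_solutions_proportional:
  assumes two: "(2::'a) \<noteq> 0"
    and 1: "\<sigma> u = a * u + b * \<sigma> t" "t = b * u + a * \<sigma> t"
    and 2: "\<sigma> u' = a * u' + b * \<sigma> t'" "t' = b * u' + a * \<sigma> t'"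
    and tau: "\<sigma> (\<sigma> (\<sigma> u)) = u" "\<sigma> (\<sigma> (\<sigma> u')) = u'" "\<sigma> (\<sigma> (\<sigma> t)) = - t" "\<sigma> (\<sigma> (\<sigma> t')) = - t'"
    and nontrivial: "u \<noteq> 0 \<or> t \<noteq> 0"
  obtains l where "u' = l * u" "t' = l * t"
proof -
  define D where "D = u * t' - u' * t"
  have "\<sigma> D = \<sigma> u * \<sigma> t' - \<sigma> u' * \<sigma> t"
    by (simp add: D_def)
  also have "\<dots> = u * (a * \<sigma> t') - u' * (a * \<sigma> t)"
    unfolding 1(1) 2(1) by (simp add: algebra_simps)
  also have "a * \<sigma> t' = t' - b * u'"
    using 2(2) by (metis add_diff_cancel_left')
  also have "a * \<sigma> t = t - b * u"
    using 1(2) by (metis add_diff_cancel_left')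
  also have "u * (t' - b * u') - u' * (t - b * u) = D"
    by (simp add: D_def algebra_simps)
  finally have "\<sigma> D = D" .
  moreover have "\<sigma> (\<sigma> (\<sigma> D)) = - D"
    by (simp add: D_def tau)
  ultimately have "2 * D = 0"
    by (metis mult_2 add.right_inverse)
  hence D: "u * t' = u' * t"
    using two by (simp add: D_def)
  show thesis
  proof (cases "u = 0")
    case True
    thus thesis
      using D nontrivial by (intro that[of "t' / t"]) auto
  next
    case False
    thus thesis
      using D by (intro that[of "u' / u"]) (auto simp: field_simps)
  qed
qed

lemma ratio_fixed_if_same_slope:
  assumes two: "(2::'a) \<noteq> 0"
    and no_root: "\<And>b. b ^ 2 = -1 \<Longrightarrow> \<sigma> b \<noteq> - b"
    and x: "x \<noteq> 0" and slopes: "\<phi> x * y = \<phi> y * x"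
  shows "\<sigma> (y / x) = y / x"
proof -
  define m where "m = \<phi> x / x"
  define a b where "a = (m + \<sigma> (\<sigma> (\<sigma> m))) / 4" and "b = (m - \<sigma> (\<sigma> (\<sigma> m))) / 4"
  define u t where "u = x + \<sigma> (\<sigma> (\<sigma> x))" and "t = \<sigma> (\<sigma> (\<sigma> (\<sigma> (\<sigma> x)))) - \<sigma> (\<sigma> x)"
  define u' t' where "u' = y + \<sigma> (\<sigma> (\<sigma> y))" and "t' = \<sigma> (\<sigma> (\<sigma> (\<sigma> (\<sigma> y)))) - \<sigma> (\<sigma> y)"
  have "\<phi> x = m * x" "\<phi> y = m * y"
    using x slopes by (auto simp: m_def field_simps)
  note sys_x = eigenspace_system[OF two this(1), folded a_def b_def u_def t_def]
    and sys_y = eigenspace_system[OF two this(2), folded a_def b_def u'_def t'_def]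
  have two_x: "2 * x = u + \<sigma> t" and two_y: "2 * y = u' + \<sigma> t'"
    by (simp_all add: u_def t_def u'_def t'_def)
  have nontrivial: "u \<noteq> 0 \<or> t \<noteq> 0"
    using two_x two x by auto
  have "\<sigma> (\<sigma> (\<sigma> u)) = u" "\<sigma> (\<sigma> (\<sigma> u')) = u'" "\<sigma> (\<sigma> (\<sigma> t)) = - t" "\<sigma> (\<sigma> (\<sigma> t')) = - t'"
    by (simp_all add: u_def u'_def t_def t'_def)
  from eigenspace_solutions_proportional[OF two sys_x sys_y this nontrivial]
  obtain l where l: "u' = l * u" "t' = l * t" .

  have "a \<noteq> 0"
  proof
    assume "a = 0"
    hence eqs: "\<sigma> u = b * \<sigma> t" "t = b * u"
      using sys_x by simp_all
    hence "u \<noteq> 0"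
      using nontrivial by auto
    moreover have "\<sigma> u = b * (\<sigma> b * \<sigma> u)"
      using eqs by (metis mult)
    ultimately have b: "b * \<sigma> b = 1"
      by simp
    hence "\<sigma> b * \<sigma> (\<sigma> b) = 1"
      by (metis mult one)
    hence "\<sigma> b * \<sigma> (\<sigma> b) = \<sigma> b * b"
      using b by (simp add: mult.commute)
    hence "\<sigma> (\<sigma> b) = b"
      using b by (metis mult_cancel_left mult_zero_right zero_neq_one)
    moreover have "\<sigma> (\<sigma> (\<sigma> b)) = - b"
      by (simp add: b_def minus_divide_left)
    ultimately have "\<sigma> b = - b"
      by simp
    moreover from this b have "b ^ 2 = -1"
      by (simp add: power2_eq_square) (metis minus_minus)
    ultimately show False
      using no_root by blast
  qed

  \<comment> \<open>Compare the system for \<open>(u', t') = (l u, l t)\<close> with the multiple of the one for \<open>(u, t)\<close>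
    by \<open>\<sigma> l\<close> in the first equation and by \<open>l\<close> in the second.\<close>
  have "\<sigma> l * (a * u + b * \<sigma> t) = a * (l * u) + b * (\<sigma> l * \<sigma> t)"
    using sys_y(1) sys_x(1) by (simp add: l)
  hence "a * ((\<sigma> l - l) * u) = 0"
    by (simp add: algebra_simps)
  moreover have "l * (b * u + a * \<sigma> t) = b * (l * u) + a * (\<sigma> l * \<sigma> t)"
    using sys_y(2) sys_x(2) by (simp add: l)
  hence "a * ((\<sigma> l - l) * \<sigma> t) = 0"
    by (auto simp: algebra_simps)
  ultimately have fixed: "\<sigma> l = l"
    using \<open>a \<noteq> 0\<close> nontrivial by (metis eq_0_iff eq_iff_diff_eq_0 mult_eq_0_iff)

  have "2 * y = l * (2 * x)"
    unfolding two_x two_y by (simp add: l fixed algebra_simps)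
  hence "y = l * x"
    using two by simp
  thus ?thesis
    using x fixed by simp
qed

lemma \<phi>_of_root:
  assumes u: "\<sigma> (\<sigma> (\<sigma> u)) = u" and b: "b ^ 2 = -1" "\<sigma> b = - b"
  shows "\<phi> (u - b * \<sigma> u) = 2 * b * (u - b * \<sigma> u)"
proof -
  have "b * (b * z) = - z" for z
    using b(1) by (metis mult.assoc mult_minus1 power2_eq_square)
  moreover have "\<phi> (u - b * \<sigma> u) = 2 * (\<sigma> u + b * u)"
    by (simp add: \<phi>_def u b(2) algebra_simps)
  ultimately show ?thesis
    by (simp add: right_diff_distrib distrib_left mult.assoc add.commute)
qed

lemma \<phi>_char_two:
  assumes "\<sigma> (\<sigma> (\<sigma> u)) = u" and "(2::'a) = 0"
  shows "\<phi> u = 0"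
proof -
  have "\<phi> u = 2 * \<sigma> u"
    by (simp add: \<phi>_def assms(1))
  thus ?thesis
    using assms(2) by simp
qed

end

section \<open>The criterion\<close>

lemma four_dvd_power_six_minus_one:
  fixes q :: nat
  assumes "odd q"
  shows "4 dvd q ^ 6 - 1"
proof -
  have "q mod 4 = 1 \<or> q mod 4 = 3"
    using assms by presburger
  hence "q ^ 6 mod 4 = 1"
    by (subst power_mod[symmetric]) auto
  thus ?thesis
    by presburger
qed

text \<open>
  There are four fourth roots of unity and only two square roots of unity, so some fourth root of
  unity has a square other than \<open>1\<close>.
\<close>

lemma exists_sqrt_minus_one:
  assumes "4 dvd CARD('a) - 1"
  obtains b :: "'a::{field,finite}" where "b ^ 2 = -1"
proof -
  have "2 dvd CARD('a) - 1"
    using assms by presburger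
  hence "card {x::'a. x ^ 2 = 1} < card {x::'a. x ^ 4 = 1}"
    using assms by (simp only: card_roots_of_unity)
  hence "\<not> {x::'a. x ^ 4 = 1} \<subseteq> {x. x ^ 2 = 1}"
    by (meson card_mono finite leD)
  then obtain b :: 'a where b: "b ^ 4 = 1" "b ^ 2 \<noteq> 1"
    by blast
  hence "(b ^ 2 - 1) * (b ^ 2 + 1) = 0"
    by (simp add: algebra_simps flip: power_add)
  thus thesis
    using b(2) by (intro that[of b]) (simp add: eq_neg_iff_add_eq_0)
qed

text \<open>
  The set \<open>{x. x ^ q ^ 3 = x}\<close> is the subfield of order \<open>q\<^sup>3\<close>, which is larger than the subfield
  of order \<open>q\<close>.
\<close>

lemma exists_in_cubic_subfield:
  assumes "q > 1" "CARD('a) = q ^ 6"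
  obtains u :: "'a::{field,finite}" where "u ^ q ^ 3 = u" "u ^ q \<noteq> u"
proof -
  have "q < q ^ 3"
    using power_strict_increasing[of 1 3 q] assms(1) by (simp only: power_one_right)
  moreover have "card {x::'a. x \<noteq> 0 \<and> x ^ q = x} = q - 1"
    using assms by (rule card_nonzero_power_eq_self)
  moreover have "card {x::'a. x \<noteq> 0 \<and> x ^ q ^ 3 = x} = q ^ 3 - 1"
    by (rule card_nonzero_power_eq_self[where n = 2]) (use assms one_less_power[of q 3] in \<open>auto simp flip: power_mult\<close>)
  ultimately have "card {x::'a. x \<noteq> 0 \<and> x ^ q = x} < card {x::'a. x \<noteq> 0 \<and> x ^ q ^ 3 = x}"
    using assms(1) by linarith
  hence "\<not> {x::'a. x \<noteq> 0 \<and> x ^ q ^ 3 = x} \<subseteq> {x::'a. x \<noteq> 0 \<and> x ^ q = x}"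
    by (meson card_mono finite leD)
  thus thesis
    using that by blast
qed

theorem theorem2p2:
  fixes q :: nat and f :: "'a::{field,finite} poly"
  assumes "primepow q"
    and "CARD('a) = q ^ 6"
    and "f = monom 1 q - monom 1 (q ^ 2) + monom 1 (q ^ 4) + monom 1 (q ^ 5)"
  shows "scattered_q_polynomial q 6 f \<longleftrightarrow> [q = 1] (mod 4)"
proof -
  have q: "q > 1"
    using primepow_gt_Suc_0[OF assms(1)] by simp
  obtain p k where p: "prime p" "k > 0" "q = p ^ k"
    using assms(1) by (auto simp: primepow_def)
  have char: "CHAR('a) = p"
    by (rule prime_char_of_card[OF p(1), of "k * 6"]) (simp add: assms(2) p(3) power_mult)
  have two: "(2::'a) = 0 \<longleftrightarrow> even q"
  proof -
    have "(2::'a) = 0 \<longleftrightarrow> CHAR('a) dvd 2"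
      by (metis of_nat_eq_0_iff_char_dvd of_nat_numeral)
    also have "\<dots> \<longleftrightarrow> p = 2"
      using char p(1) by (metis dvd_refl primes_dvd_imp_eq two_is_prime_nat)
    also have "\<dots> \<longleftrightarrow> even q"
      using p by (metis dvd_refl even_power primes_dvd_imp_eq two_is_prime_nat)
    finally show ?thesis .
  qed

  define \<sigma> :: "'a \<Rightarrow> 'a" where "\<sigma> x = x ^ q" for x
  have power_card: "x ^ q ^ 6 = x" for x :: 'a
    using finite_field_power_card_minus_one[of x] q
    by (subst power_eq_self_iff) (auto simp: assms(2))
  interpret automorphism_of_exponent_six \<sigma>
  proof
    show "\<sigma> (x + y) = \<sigma> x + \<sigma> y" for x y
      unfolding \<sigma>_def by (rule freshmans_dream'[where n = k]) (use p char in auto)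
    show "\<sigma> (\<sigma> (\<sigma> (\<sigma> (\<sigma> (\<sigma> x))))) = x" for x
      using power_card[of x] by (simp add: \<sigma>_def eval_nat_numeral mult.assoc flip: power_mult)
  qed (simp_all add: \<sigma>_def power_mult_distrib)

  have f: "poly f x = \<phi> x" for x
    by (simp add: assms(3) \<phi>_def \<sigma>_def poly_monom eval_nat_numeral mult.assoc flip: power_mult)
  have "q_polynomial q 6 f"
    unfolding q_polynomial_def
    by (rule exI[of _ "\<lambda>i. if i = 2 then -1 else if i \<in> {1, 4, 5} then 1 else 0"])
      (simp add: assms(3) eval_nat_numeral minus_monom)
  moreover have "poly f (c * x) = c * poly f x" if "c ^ q = c" for c x
    using that by (simp add: f \<phi>_def flip: \<sigma>_def) (simp add: algebra_simps)
  ultimately have scattered_iff: "scattered_q_polynomial q 6 f \<longleftrightarrow>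
      (\<forall>x y. x \<noteq> 0 \<longrightarrow> \<phi> x * y = \<phi> y * x \<longrightarrow> \<sigma> (y / x) = y / x)"
    unfolding scattered_q_polynomial_def
    using card_linear_set_graph_iff[OF q assms(2)] by (simp add: f \<sigma>_def)

  have root: "\<sigma> b = b ^ (q mod 4)" if "b ^ 2 = -1" for b
  proof -
    have "b ^ 4 = 1"
      using that power_mult[of b 2 2] by simp
    moreover have "\<sigma> b = (b ^ 4) ^ (q div 4) * b ^ (q mod 4)"
      by (simp add: \<sigma>_def flip: power_mult power_add)
    ultimately show ?thesis
      by simp
  qed
  obtain w :: 'a where "w ^ q ^ 3 = w" "w ^ q \<noteq> w"
    using exists_in_cubic_subfield[OF q assms(2)] by blast
  hence w: "\<sigma> (\<sigma> (\<sigma> w)) = w" "\<sigma> w \<noteq> w"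
    by (simp_all add: \<sigma>_def eval_nat_numeral mult.assoc flip: power_mult)

  have "even q \<or> q mod 4 = 1 \<or> q mod 4 = 3"
    by presburger
  then consider "even q" | "q mod 4 = 1" | "q mod 4 = 3"
    by blast
  thus ?thesis
  proof cases
    case 1
    hence "\<phi> 1 * w = \<phi> w * 1"
      using two w(1) by (simp add: \<phi>_char_two)
    hence "\<not> scattered_q_polynomial q 6 f"
      using w(2) scattered_iff by (metis div_by_1 zero_neq_one)
    moreover have "\<not> [q = 1] (mod 4)"
      using 1 unfolding cong_def by presburger
    ultimately show ?thesis
      by simp
  next
    case 2
    hence odd: "odd q"
      by presburger
    have "\<sigma> b \<noteq> - b" if "b ^ 2 = -1" for b
    proof
      assume "\<sigma> b = - b"
      hence "2 * b = 0"
        using root[OF that] 2 by (simp add: eq_neg_iff_add_eq_0)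
      thus False
        using two odd that by simp
    qed
    hence "scattered_q_polynomial q 6 f"
      using ratio_fixed_if_same_slope two odd unfolding scattered_iff by blast
    thus ?thesis
      using 2 by (simp add: cong_def)
  next
    case 3
    hence odd: "odd q"
      by presburger
    obtain b :: 'a where b: "b ^ 2 = -1"
      using exists_sqrt_minus_one four_dvd_power_six_minus_one[OF odd] assms(2) by metis
    have sigma_b: "\<sigma> b = - b"
      using root[OF b] 3 b by (simp add: power3_eq_cube power2_eq_square)
    \<comment> \<open>The elements of slope \<open>2 b\<close> obtained from \<open>u = 1\<close> and \<open>u = w\<close>.\<close>
    define x y where "x = 1 - b" and "y = w - b * \<sigma> w"
    have "x \<noteq> 0"
      using b two odd by (auto simp: x_def eq_neg_iff_add_eq_0)
    have "\<phi> x = 2 * b * x" "\<phi> y = 2 * b * y"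
      using \<phi>_of_root[OF _ b sigma_b, of 1] \<phi>_of_root[OF w(1) b sigma_b]
      by (simp_all add: x_def y_def)
    hence "\<phi> x * y = \<phi> y * x"
      by simp
    moreover have "\<sigma> (y / x) \<noteq> y / x"
    proof
      define c where "c = y / x"
      assume "\<sigma> (y / x) = y / x"
      hence c: "\<sigma> c = c"
        by (simp add: c_def)
      have "w - b * \<sigma> w = c * (1 - b)"
        using \<open>x \<noteq> 0\<close> by (simp add: c_def flip: x_def y_def)
      \<comment> \<open>Applying \<open>\<tau>\<close> flips the sign of \<open>b\<close>, so the components fixed by \<open>\<tau>\<close> agree.\<close>
      moreover from arg_cong[OF this, of "\<lambda>z. \<sigma> (\<sigma> (\<sigma> z))"]
      have "w + b * \<sigma> w = c * (1 + b)"
        by (simp add: c sigma_b w(1))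
      ultimately have "(w - b * \<sigma> w) + (w + b * \<sigma> w) = c * (1 - b) + c * (1 + b)"
        by (simp only:)
      hence "2 * w = 2 * c"
        by (simp add: algebra_simps)
      hence "w = c"
        using two odd by simp
      thus False
        using c w(2) by simp
    qed
    ultimately have "\<not> scattered_q_polynomial q 6 f"
      using \<open>x \<noteq> 0\<close> scattered_iff by blast
    thus ?thesis
      using 3 by (simp add: cong_def)
  qed
qed

end
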